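(* Let $a<b$ be real numbers, let $I=[a,b]$, and let $F:I\to\mathbb{R}$ be a function satisfying both of the following: (i) $F'$ exists and is equal to zero in a dense subset of $I$; that is, there is a dense subset $D$ of $I$ such that for every $x\in D$ the function $F$ is differentiable at $x$ and $F'(x)=0$; (ii) $F$ is an indefinite Riemann integral; that is, there exist a Riemann-integrable function $f:I\to\mathbb{R}$ and a constant $c\in\mathbb{R}$ such that $$F(x)=c+\int_a^x f(y)\,dy \quad\text{for all } x\in I.$$ Then $F$ is constant in $I$.
   Context: The integral is the (proper) Riemann integral. Derivatives at the endpoints of $I$, if considered, are one-sided. *)

theory Defs
  imports "HOL-Analysis.Analysis"
begin

text \<open>
  The proper Riemann integral of a real function over the interval from \<open>a\<close> to \<open>b\<close>, as the
  limit of Riemann sums when the mesh tends to zero. In contrast to the Henstock-Kurzweil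
  integral \<^const>\<open>has_integral\<close>, the bound \<open>d\<close> on the lengths of the subintervals
  (\<^const>\<open>diameter\<close>) is a constant, not a gauge depending on the tag.
  Only the case \<open>a \<le> b\<close> is meaningful: no sign convention for \<open>b < a\<close> is built in.
\<close>

definition has_riemann_integral :: "(real \<Rightarrow> real) \<Rightarrow> real \<Rightarrow> real \<Rightarrow> real \<Rightarrow> bool" where
  "has_riemann_integral f J a b \<longleftrightarrow>
     (\<forall>e>0. \<exists>d>0. \<forall>p. p tagged_division_of {a..b} \<and> (\<forall>(x, K)\<in>p. diameter K < d) \<longrightarrow>
        \<bar>(\<Sum>(x, K)\<in>p. measure lborel K * f x) - J\<bar> < e)"

definition riemann_integrable :: "(real \<Rightarrow> real) \<Rightarrow> real \<Rightarrow> real \<Rightarrow> bool" where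
  "riemann_integrable f a b \<longleftrightarrow> (\<exists>J. has_riemann_integral f J a b)"

definition riemann_integral :: "(real \<Rightarrow> real) \<Rightarrow> real \<Rightarrow> real \<Rightarrow> real" where
  "riemann_integral f a b = (THE J. has_riemann_integral f J a b)"

lemma has_riemann_integral_imp_has_integral:
  assumes "has_riemann_integral f J a b"
  shows "(f has_integral J) {a..b}"
proof -
  have "\<exists>\<gamma>. gauge \<gamma> \<and> (\<forall>p. p tagged_division_of {a..b} \<and> \<gamma> fine p \<longrightarrow>
          norm ((\<Sum>(x, K)\<in>p. measure lborel K *\<^sub>R f x) - J) < e)" if "e > 0" for e
  proof -
    obtain d where d: "d > 0"
      "\<And>p. p tagged_division_of {a..b} \<Longrightarrow> (\<forall>(x, K)\<in>p. diameter K < d) \<Longrightarrow>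
         \<bar>(\<Sum>(x, K)\<in>p. measure lborel K * f x) - J\<bar> < e"
      using assms[unfolded has_riemann_integral_def, rule_format, OF \<open>e > 0\<close>] by metis
    have "norm ((\<Sum>(x, K)\<in>p. measure lborel K *\<^sub>R f x) - J) < e"
      if p: "p tagged_division_of {a..b}" "(\<lambda>x. ball x (d/3)) fine p" for p
    proof -
      have "diameter K < d" if "(x, K) \<in> p" for x K
      proof -
        have "K \<subseteq> ball x (d/3)" using p(2) that unfolding fine_def by blast
        then have "diameter K \<le> diameter (ball x (d/3))"
          by (intro diameter_subset) auto
        then show ?thesis using d(1) by simp
      qed
      then have "\<bar>(\<Sum>(x, K)\<in>p. measure lborel K * f x) - J\<bar> < e"
        by (intro d(2)[OF p(1)]) auto
      then show ?thesis
        by (simp only: real_norm_def real_scaleR_def)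
    qed
    then show ?thesis
      using gauge_ball[of "d/3"] d(1) by (intro exI[of _ "\<lambda>x. ball x (d/3)"]) simp
  qed
  then show ?thesis
    unfolding has_integral_real by simp
qed

lemma has_riemann_integral_riemann_integral:
  assumes "riemann_integrable f a b"
  shows "has_riemann_integral f (riemann_integral f a b) a b"
proof -
  have "\<exists>!J. has_riemann_integral f J a b"
    using assms unfolding riemann_integrable_def
    by (blast intro: has_integral_unique has_riemann_integral_imp_has_integral)
  then show ?thesis
    unfolding riemann_integral_def by (rule theI')
qed

end

theory Submission
  imports Defs
begin

text \<open>
  If \<open>f\<close> exceeded some \<open>M > 0\<close> throughout a nondegenerate subinterval, \<open>F\<close> would have slope at
  least \<open>M\<close> there, contradicting \<open>F' = 0\<close> at a point of \<open>D\<close> inside it. Hence every subinterval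
  contains a point where \<open>f \<le> M\<close>, and choosing these points as tags gives Riemann sums over
  \<open>[a, x]\<close> of arbitrarily small mesh that are at most \<open>M (x - a)\<close>. So the integral over \<open>[a, x]\<close>
  is at most \<open>0\<close>, and by symmetry (replace \<open>f\<close> by \<open>- f\<close>) it vanishes.
\<close>

text \<open>The mesh bound on \<open>{a..b}\<close> acts as a gauge of constant radius, so
  Henstock's lemma controls the error over any fine partial division. A tagged division of
  \<open>{u..v}\<close> is such a partial division, and no extension to all of \<open>{a..b}\<close>
  has to be built.\<close>

lemma has_riemann_integral_subinterval:
  assumes "has_riemann_integral f J a b" and "{u..v} \<subseteq> {a..b}"
  shows "has_riemann_integral f (integral {u..v} f) u v"
  unfolding has_riemann_integral_def
proof (intro allI impI)
  fix e :: real assume "e > 0"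
  have hi: "(f has_integral J) {a..b}"
    using assms(1) by (rule has_riemann_integral_imp_has_integral)
  then have int: "f integrable_on cbox a b" and J: "integral (cbox a b) f = J"
    by (auto simp: has_integral_integrable_integral)
  obtain d where d: "d > 0"
    "\<And>p. p tagged_division_of {a..b} \<Longrightarrow> (\<forall>(x, K)\<in>p. diameter K < d) \<Longrightarrow>
       \<bar>(\<Sum>(x, K)\<in>p. measure lborel K * f x) - J\<bar> < e/2"
    using assms(1)[unfolded has_riemann_integral_def, rule_format, OF half_gt_zero[OF \<open>e > 0\<close>]]
    by metis
  \<comment> \<open>A cell inside such a ball has diameter at most \<open>2 * d / 3\<close>, which
    is strictly below \<open>d\<close>.\<close>
  let ?g = "\<lambda>x::real. ball x (d/3)"
  have fine: "norm ((\<Sum>(x, K)\<in>p. measure lborel K *\<^sub>R f x) - integral (cbox a b) f) < e/2"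
    if p: "p tagged_division_of cbox a b" "?g fine p" for p
  proof -
    have "diameter K < d" if "(x, K) \<in> p" for x K
    proof -
      have "K \<subseteq> ball x (d/3)" using p(2) that unfolding fine_def by blast
      then have "diameter K \<le> diameter (ball x (d/3))"
        by (intro diameter_subset) auto
      then show ?thesis using d(1) by simp
    qed
    then show ?thesis
      using d(2)[of p] p(1) J by auto
  qed
  show "\<exists>d>0. \<forall>p. p tagged_division_of {u..v} \<and> (\<forall>(x, K)\<in>p. diameter K < d) \<longrightarrow>
        \<bar>(\<Sum>(x, K)\<in>p. measure lborel K * f x) - integral {u..v} f\<bar> < e"
  \<comment> \<open>A cell contains its tag, so diameter below \<open>d/3\<close> forces it into the
    ball of radius \<open>d/3\<close> about the tag.\<close>
  proof (intro exI[of _ "d/3"] conjI allI impI)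
    fix p assume "p tagged_division_of {u..v} \<and> (\<forall>(x, K)\<in>p. diameter K < d/3)"
    then have p: "p tagged_division_of {u..v}"
      and small: "\<And>x K. (x, K) \<in> p \<Longrightarrow> diameter K < d/3" by auto
    have partial: "p tagged_partial_division_of cbox a b"
      using p assms(2) unfolding tagged_division_of_def tagged_partial_division_of_def
      by (metis box_real(2) order_trans)
    have finep: "?g fine p"
      unfolding fine_def
    proof (clarify)
      fix x K y assume xK: "(x, K) \<in> p" and y: "y \<in> K"
      have "x \<in> K" "bounded K"
        using tagged_division_ofD(2,4)[OF p xK] bounded_cbox by auto
      then have "dist x y \<le> diameter K"
        using y by (intro diameter_bounded_bound) auto
      then show "y \<in> ball x (d/3)" using small[OF xK] by simp
    qed
    \<comment> \<open>Henstock's lemma yields only a non-strict bound; starting from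
      \<open>e/2\<close> leaves room for the strict one.\<close>
    have "norm (\<Sum>(x, K)\<in>p. measure lborel K *\<^sub>R f x - integral K f) \<le> e/2"
      using Henstock_lemma_part1[OF int half_gt_zero[OF \<open>e > 0\<close>] _ fine partial finep] d(1)
      by (simp add: gauge_ball)
    moreover have "integral {u..v} f = (\<Sum>(x, K)\<in>p. integral K f)"
      using integral_combine_tagged_division_topdown[of f u v p] p
        integrable_subinterval_real[of f a b u v] int assms(2) by simp
    ultimately show "\<bar>(\<Sum>(x, K)\<in>p. measure lborel K * f x) - integral {u..v} f\<bar> < e"
      using \<open>e > 0\<close> by (simp add: sum_subtractf split_def)
  qed (use d in auto)
qed

text \<open>Replaces the definite description by the gauge integral, so that the library's
  integration lemmas apply.\<close>

lemma riemann_integral_eq_integral: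
  assumes "has_riemann_integral f J a b"
  shows "riemann_integral f a b = integral {a..b} f"
  using has_riemann_integral_riemann_integral[of f a b] assms
    has_riemann_integral_imp_has_integral integral_unique
  unfolding riemann_integrable_def by metis

lemma has_riemann_integral_minus:
  assumes "has_riemann_integral f J a b"
  shows "has_riemann_integral (\<lambda>x. - f x) (- J) a b"
proof -
  have "\<bar>(\<Sum>(x, K)\<in>p. measure lborel K * - f x) - - J\<bar> =
    \<bar>(\<Sum>(x, K)\<in>p. measure lborel K * f x) - J\<bar>" for p :: "(real \<times> real set) set"
    by (simp add: split_def sum_negf abs_minus_commute)
  then show ?thesis
    using assms unfolding has_riemann_integral_def by simp
qed

text \<open>The mesh condition ignores the tags, so a division into small cells may be retagged at
  will without losing the estimate. A gauge depending on the tag would not allow this.\<close>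

lemma has_riemann_integral_le:
  assumes f: "has_riemann_integral f J a b" and "a \<le> b"
    and tag: "\<And>u v. u < v \<Longrightarrow> {u..v} \<subseteq> {a..b} \<Longrightarrow> \<exists>t\<in>{u..v}. f t \<le> M"
  shows "J \<le> M * (b - a)"
proof (rule field_le_epsilon)
  fix e :: real assume "e > 0"
  obtain d where d: "d > 0"
    "\<And>p. p tagged_division_of {a..b} \<Longrightarrow> (\<forall>(x, K)\<in>p. diameter K < d) \<Longrightarrow>
       \<bar>(\<Sum>(x, K)\<in>p. measure lborel K * f x) - J\<bar> < e"
    using f[unfolded has_riemann_integral_def, rule_format, OF \<open>e > 0\<close>] by metis
  \<comment> \<open>Cousin's lemma serves only to provide cells of small diameter; the tags of
    \<open>q\<close> are discarded.\<close>
  obtain q where q: "q tagged_division_of cbox a b" "(\<lambda>x. ball x (d/3)) fine q"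
    using fine_division_exists[of "\<lambda>x. ball x (d/3)" a b] d(1) gauge_ball[of "d/3"] by auto
  define \<D> where "\<D> = snd ` q"
  have D: "\<D> division_of {a..b}"
    using division_of_tagged_division[OF q(1)] by (simp add: \<D>_def)
  have small: "diameter K < d" if K: "K \<in> \<D>" for K
  proof -
    obtain x where "(x, K) \<in> q" using K by (auto simp: \<D>_def)
    then have "K \<subseteq> ball x (d/3)" using q(2) unfolding fine_def by blast
    then have "diameter K \<le> diameter (ball x (d/3))"
      by (intro diameter_subset) auto
    then show ?thesis using d(1) by simp
  qed
  \<comment> \<open>Weighting by the measure covers degenerate cells, where \<open>tag\<close> says
    nothing but both sides are \<open>0\<close>.\<close>
  have "\<exists>t\<in>K. measure lborel K * f t \<le> measure lborel K * M" if K: "K \<in> \<D>" for K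
  proof -
    obtain u v where uv: "K = {u..v}" using division_ofD(4)[OF D K] by auto
    have sub: "K \<subseteq> {a..b}" and "K \<noteq> {}"
      using division_ofD(2,3)[OF D K] by auto
    then consider "u = v" | "u < v" using uv by fastforce
    then show ?thesis
    proof cases
      case 1 then show ?thesis using uv by auto
    next
      case 2
      then show ?thesis using tag[of u v] sub uv by (meson measure_nonneg mult_left_mono)
    qed
  qed
  then obtain t where t: "\<And>K. K \<in> \<D> \<Longrightarrow> t K \<in> K"
    and le: "\<And>K. K \<in> \<D> \<Longrightarrow> measure lborel K * f (t K) \<le> measure lborel K * M" by metis
  let ?p = "(\<lambda>K. (t K, K)) ` \<D>"
  have "?p tagged_division_of {a..b}"
  proof (rule tagged_division_ofI)
    show "finite ?p" using division_ofD(1)[OF D] by simp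
    show "\<Union> {K. \<exists>x. (x, K) \<in> ?p} = {a..b}"
    proof -
      have "{K. \<exists>x. (x, K) \<in> ?p} = \<D>" by auto
      then show ?thesis using division_ofD(6)[OF D] by simp
    qed
  next
    fix x K assume "(x, K) \<in> ?p"
    then have K: "K \<in> \<D>" "x = t K" by auto
    show "x \<in> K" using t K by simp
    show "K \<subseteq> {a..b}" using division_ofD(2)[OF D K(1)] .
    show "\<exists>u v. K = cbox u v" using division_ofD(4)[OF D K(1)] .
    fix y L assume "(y, L) \<in> ?p" "(x, K) \<noteq> (y, L)"
    then have "L \<in> \<D>" "K \<noteq> L" using K by auto
    then show "interior K \<inter> interior L = {}" using division_ofD(5)[OF D K(1)] by simp
  qed
  then have "\<bar>(\<Sum>(x, K)\<in>?p. measure lborel K * f x) - J\<bar> < e"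
    using small by (intro d(2)) auto
  then have "J - e < (\<Sum>(x, K)\<in>?p. measure lborel K * f x)"
    by linarith
  also have "\<dots> = (\<Sum>K\<in>\<D>. measure lborel K * f (t K))"
    by (subst sum.reindex) (auto simp: inj_on_def)
  also have "\<dots> \<le> (\<Sum>K\<in>\<D>. measure lborel K * M)"
    using le by (rule sum_mono)
  also have "\<dots> = M * (b - a)"
    using additive_content_division[of \<D> a b] D \<open>a \<le> b\<close>
    by (simp add: sum_distrib_right[symmetric])
  finally show "J \<le> M * (b - a) + e" by simp
qed

lemma integrand_le_on_subinterval:
  fixes f F :: "real \<Rightarrow> real"
  assumes int: "f integrable_on {a..b}"
    and F: "\<And>x. x \<in> {a..b} \<Longrightarrow> F x = c + integral {a..x} f"
    and closure: "{a..b} \<subseteq> closure D"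
    and deriv: "\<And>x. x \<in> D \<Longrightarrow> (F has_real_derivative 0) (at x within {a..b})"
    and "M > 0" and "u < v" and sub: "{u..v} \<subseteq> {a..b}"
  shows "\<exists>t\<in>{u..v}. f t \<le> M"
proof (rule ccontr)
  assume "\<not> ?thesis"
  then have gt: "\<And>t. t \<in> {u..v} \<Longrightarrow> M \<le> f t" by force
  have ab: "a \<le> u" "v \<le> b" using sub \<open>u < v\<close> by auto
  obtain m where "m \<in> {u<..<v}" using Orderings.dense[OF \<open>u < v\<close>] by auto
  moreover from this have "m \<in> closure D" using closure ab by auto
  ultimately have "D \<inter> {u<..<v} \<noteq> {}"
    using open_Int_closure_eq_empty[OF open_greaterThanLessThan, of u v D] by blast
  then obtain z where z: "z \<in> D" "u < z" "z < v" by auto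
  \<comment> \<open>Density was applied to the open interval, so \<open>z\<close> is interior and
    the derivative there is two-sided.\<close>
  have "at z within {a..b} = at z"
    using z ab by (intro at_within_interior) auto
  then have "(F has_real_derivative 0) (at z)" using deriv[OF z(1)] by simp
  \<comment> \<open>Subtracting \<open>M * y\<close> makes the derivative strictly negative, so
    \<open>F (z + h) - F z < M * h\<close> for small \<open>h > 0\<close>.\<close>
  then have "((\<lambda>y. F y - M * y) has_real_derivative - M) (at z)"
    by (auto intro!: derivative_eq_intros)
  then obtain d where d: "d > 0" "\<And>h. 0 < h \<Longrightarrow> h < d \<Longrightarrow> F (z + h) - M * (z + h) < F z - M * z"
    using DERIV_neg_dec_right[of "\<lambda>y. F y - M * y" "- M" z] \<open>M > 0\<close> by auto
  \<comment> \<open>The first bound puts \<open>h\<close> strictly below \<open>d\<close>; the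
    second keeps \<open>{z..z + h}\<close> where \<open>f\<close> is at least
    \<open>M\<close>.\<close>
  define h where "h = min (d/2) (v - z)"
  have h: "0 < h" "h < d" "z + h \<le> v" using d(1) z unfolding h_def by auto
  have int_z: "f integrable_on {z..z + h}"
    using int integrable_subinterval_real z h ab by (metis atLeastatMost_subset_iff
      less_eq_real_def order_trans)
  have "M * h = integral {z..z + h} (\<lambda>_. M)" using h by simp
  also have "\<dots> \<le> integral {z..z + h} f"
    using gt z h int_z by (intro integral_le) auto
  also have "\<dots> = F (z + h) - F z"
  proof -
    have "f integrable_on {a..z + h}"
      using int h ab z by (auto intro: integrable_subinterval_real)
    then show ?thesis
      using Henstock_Kurzweil_Integration.integral_combine[of a z "z + h" f] F[of z] F[of "z + h"]
        z h ab by simp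
  qed
  finally show False using d(2)[OF h(1,2)] by (simp add: algebra_simps)
qed

lemma indefinite_riemann_integral_le_0:
  fixes f F :: "real \<Rightarrow> real"
  assumes f: "has_riemann_integral f J a b"
    and F: "\<And>x. x \<in> {a..b} \<Longrightarrow> F x = c + integral {a..x} f"
    and closure: "{a..b} \<subseteq> closure D"
    and deriv: "\<And>x. x \<in> D \<Longrightarrow> (F has_real_derivative 0) (at x within {a..b})"
    and x: "x \<in> {a..b}"
  shows "integral {a..x} f \<le> 0"
proof -
  have int: "f integrable_on {a..b}"
    using has_riemann_integral_imp_has_integral[OF f] by blast
  have sub: "{a..x} \<subseteq> {a..b}" using x by auto
  have le: "integral {a..x} f \<le> M * (x - a)" if "M > 0" for M
    using x integrand_le_on_subinterval[OF int F closure deriv that] sub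
    by (intro has_riemann_integral_le[OF has_riemann_integral_subinterval[OF f sub]]) auto
  show ?thesis
  proof (rule field_le_epsilon)
    fix e :: real assume "e > 0"
    have "x - a \<ge> 0" using x by simp
    \<comment> \<open>The summand \<open>1\<close> keeps the denominator positive when
      \<open>x = a\<close>.\<close>
    then have "e / (x - a + 1) * (x - a) \<le> e"
      using \<open>e > 0\<close> by (simp add: field_simps)
    then show "integral {a..x} f \<le> 0 + e"
      using le[of "e / (x - a + 1)"] \<open>e > 0\<close> \<open>x - a \<ge> 0\<close> by simp
  qed
qed

theorem theorem1p2:
  fixes a b :: real and F :: "real \<Rightarrow> real"
  assumes "a < b"
    and "\<exists>D. D \<subseteq> {a..b} \<and> {a..b} \<subseteq> closure D \<and>
           (\<forall>x\<in>D. (F has_real_derivative 0) (at x within {a..b}))"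
    and "\<exists>f c. riemann_integrable f a b \<and>
           (\<forall>x\<in>{a..b}. F x = c + riemann_integral f a x)"
  shows "F constant_on {a..b}"
proof -
  obtain D where D: "{a..b} \<subseteq> closure D"
    "\<And>x. x \<in> D \<Longrightarrow> (F has_real_derivative 0) (at x within {a..b})"
    using assms(2) by blast
  obtain f c J where f: "has_riemann_integral f J a b"
    and F: "\<And>x. x \<in> {a..b} \<Longrightarrow> F x = c + riemann_integral f a x"
    using assms(3) unfolding riemann_integrable_def by blast
  have F': "F x = c + integral {a..x} f" if "x \<in> {a..b}" for x
    using F[OF that] that
      riemann_integral_eq_integral[OF has_riemann_integral_subinterval[OF f, of a x]] by auto
  have "integral {a..x} f = 0" if x: "x \<in> {a..b}" for x
  proof (rule antisym)
    show "integral {a..x} f \<le> 0"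
      by (rule indefinite_riemann_integral_le_0[OF f F' D x])
    \<comment> \<open>The hypotheses are invariant under negating both \<open>F\<close> and
      \<open>f\<close>, which gives the reverse inequality.\<close>
    have "((\<lambda>x. - F x) has_real_derivative 0) (at x within {a..b})" if "x \<in> D" for x
      using DERIV_minus[OF D(2)[OF that]] by simp
    then have "integral {a..x} (\<lambda>y. - f y) \<le> 0"
      using F' by (intro indefinite_riemann_integral_le_0[where F = "\<lambda>x. - F x" and c = "- c",
        OF has_riemann_integral_minus[OF f] _ D(1) _ x]) auto
    then show "0 \<le> integral {a..x} f" by simp
  qed
  then show ?thesis
    using F' unfolding constant_on_def by auto
qed

end
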